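(* Let $\nu\colon\mathbb{R}_{>0}\times\mathbb{N}\to\mathbb{N}\cup\{0,\infty\}$ be monotone non-decreasing in the first argument. Every finitely generated residually finite BS-rigid (resp. $\nu$-flexibly BS-rigid) group is weakly stable (resp. $\nu$-flexibly weakly stable).
   Context: Write $[n]=\{1,\dots,n\}$ and $\mathrm{Sym}(n)$ for the symmetric group on $[n]$. For $\sigma\in\mathrm{Sym}(n)$ and $\tau\in\mathrm{Sym}(M)$ with $M\ge n$, $d(\sigma,\tau)=d(\tau,\sigma)=\frac1n|\{x\in[n]\mid\sigma x\neq\tau x\}|$. For a group $\Gamma$, $f\colon\Gamma\to\mathrm{Sym}(n)$ and finite $Q\subset\Gamma$, $N_{f,Q}$ is the distribution on $2^Q$ of $\{\gamma\in Q\mid f(\gamma)x=x\}$ with $x$ uniform in $[n]$; $d_{\mathrm{TV}}$ is total variation distance (half the $\ell^1$ distance). Call a sequence of functions $(f_\ell\colon\Gamma\to\mathrm{Sym}(n_\ell))_{\ell=1}^\infty$ with $n_\ell\to\infty$ an asymptotic homomorphism if $d(f_\ell(\gamma_1\gamma_2),f_\ell(\gamma_1)f_\ell(\gamma_2))\to0$ for all $\gamma_1,\gamma_2\in\Gamma$. Call it $\nu$-correctable if there are positive reals $\varepsilon_\ell\to0$ and homomorphisms $(h_\ell\colon\Gamma\to\mathrm{Sym}(N_\ell))_{\ell=1}^\infty$ with $n_\ell\le N_\ell\le n_\ell+\nu(\varepsilon_\ell,n_\ell)$ such that $d(f_\ell(\gamma),h_\ell(\gamma))\to0$ for all $\gamma\in\Gamma$.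 $\Gamma$ is $\nu$-flexibly BS-rigid if every asymptotic homomorphism $(f_\ell)$ for which there exist homomorphisms $(g_\ell\colon\Gamma\to\mathrm{Sym}(n_\ell))_{\ell=1}^\infty$ with $d_{\mathrm{TV}}(N_{f_\ell,Q},N_{g_\ell,Q})\to0$ for every finite $Q\subset\Gamma$ is $\nu$-correctable. $\Gamma$ is $\nu$-flexibly weakly stable if every asymptotic homomorphism $(f_\ell)$ satisfying $d(f_\ell(\gamma),1_{\mathrm{Sym}(n_\ell)})\to1$ for all $\gamma\in\Gamma\setminus\{1_\Gamma\}$ is $\nu$-correctable. BS-rigid and weakly stable mean the respective notions with $\nu=0$. *)

theory Defs
  imports
    "HOL-Algebra.Sym_Groups"
    "HOL-Probability.Probability_Mass_Function"
    "HOL-Library.Extended_Nat"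
begin

definition finitely_generated_group :: "('a, 'b) monoid_scheme \<Rightarrow> bool" where
  "finitely_generated_group G \<longleftrightarrow>
     group G \<and> (\<exists>S. finite S \<and> S \<subseteq> carrier G \<and> generate G S = carrier G)"

definition residually_finite_group :: "('a, 'b) monoid_scheme \<Rightarrow> bool" where
  "residually_finite_group G \<longleftrightarrow>
     group G \<and>
     (\<forall>g \<in> carrier G. g \<noteq> \<one>\<^bsub>G\<^esub> \<longrightarrow>
        (\<exists>H. H \<lhd> G \<and> finite (carrier (G Mod H)) \<and> g \<notin> H))"

text \<open>
  The distance between \<open>\<sigma> \<in> Sym(n)\<close> and \<open>\<tau> \<in> Sym(m)\<close>. The degrees are explicit arguments because
  a permutation in \<^const>\<open>sym_group\<close> is a function on all of \<open>nat\<close>. It is normalised by the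
  smaller of the two degrees, and only points of the smaller of the two sets are counted.
\<close>

definition perm_dist :: "nat \<Rightarrow> nat \<Rightarrow> (nat \<Rightarrow> nat) \<Rightarrow> (nat \<Rightarrow> nat) \<Rightarrow> real" where
  "perm_dist n m \<sigma> \<tau> = real (card {x \<in> {1..min n m}. \<sigma> x \<noteq> \<tau> x}) / real (min n m)"

text \<open>The distribution \<open>N\<^sub>f\<^sub>,\<^sub>Q\<close> on \<open>Pow Q\<close>, for \<open>f\<close> with values in \<open>Sym(n)\<close>, \<open>n \<ge> 1\<close>.\<close>

definition fix_distr :: "nat \<Rightarrow> ('a \<Rightarrow> nat \<Rightarrow> nat) \<Rightarrow> 'a set \<Rightarrow> 'a set pmf" where
  "fix_distr n f Q = map_pmf (\<lambda>x. {\<gamma> \<in> Q. f \<gamma> x = x}) (pmf_of_set {1..n})"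

text \<open>Total variation distance of two distributions on a finite set \<open>X\<close>.\<close>

definition tv_dist :: "'c set \<Rightarrow> 'c pmf \<Rightarrow> 'c pmf \<Rightarrow> real" where
  "tv_dist X p q = (1 / 2) * (\<Sum>x\<in>X. \<bar>pmf p x - pmf q x\<bar>)"

text \<open>Sequences are indexed by all of \<open>nat\<close>, that is, from 0 rather than from 1.\<close>

definition asymptotic_hom ::
    "('a, 'b) monoid_scheme \<Rightarrow> (nat \<Rightarrow> nat) \<Rightarrow> (nat \<Rightarrow> 'a \<Rightarrow> nat \<Rightarrow> nat) \<Rightarrow> bool" where
  "asymptotic_hom G n f \<longleftrightarrow>
     (\<forall>l. 1 \<le> n l) \<and> filterlim n at_top sequentially \<and>
     (\<forall>l. f l \<in> carrier G \<rightarrow> carrier (sym_group (n l))) \<and>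
     (\<forall>\<gamma>1 \<in> carrier G. \<forall>\<gamma>2 \<in> carrier G.
        (\<lambda>l. perm_dist (n l) (n l) (f l (\<gamma>1 \<otimes>\<^bsub>G\<^esub> \<gamma>2))
               (f l \<gamma>1 \<otimes>\<^bsub>sym_group (n l)\<^esub> f l \<gamma>2)) \<longlonglongrightarrow> 0)"

definition correctable ::
    "(real \<Rightarrow> nat \<Rightarrow> enat) \<Rightarrow> ('a, 'b) monoid_scheme \<Rightarrow> (nat \<Rightarrow> nat) \<Rightarrow>
     (nat \<Rightarrow> 'a \<Rightarrow> nat \<Rightarrow> nat) \<Rightarrow> bool" where
  "correctable \<nu> G n f \<longleftrightarrow>
     (\<exists>(\<epsilon> :: nat \<Rightarrow> real) (N :: nat \<Rightarrow> nat) (h :: nat \<Rightarrow> 'a \<Rightarrow> nat \<Rightarrow> nat).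
        (\<forall>l. 0 < \<epsilon> l) \<and> \<epsilon> \<longlonglongrightarrow> 0 \<and>
        (\<forall>l. h l \<in> hom G (sym_group (N l))) \<and>
        (\<forall>l. n l \<le> N l \<and> enat (N l) \<le> enat (n l) + \<nu> (\<epsilon> l) (n l)) \<and>
        (\<forall>\<gamma> \<in> carrier G. (\<lambda>l. perm_dist (n l) (N l) (f l \<gamma>) (h l \<gamma>)) \<longlonglongrightarrow> 0))"

definition flexibly_BS_rigid ::
    "(real \<Rightarrow> nat \<Rightarrow> enat) \<Rightarrow> ('a, 'b) monoid_scheme \<Rightarrow> bool" where
  "flexibly_BS_rigid \<nu> G \<longleftrightarrow>
     (\<forall>n f. asymptotic_hom G n f \<and>
        (\<exists>g. (\<forall>l. g l \<in> hom G (sym_group (n l))) \<and>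
             (\<forall>Q. finite Q \<and> Q \<subseteq> carrier G \<longrightarrow>
                (\<lambda>l. tv_dist (Pow Q) (fix_distr (n l) (f l) Q) (fix_distr (n l) (g l) Q))
                  \<longlonglongrightarrow> 0))
        \<longrightarrow> correctable \<nu> G n f)"

definition flexibly_weakly_stable ::
    "(real \<Rightarrow> nat \<Rightarrow> enat) \<Rightarrow> ('a, 'b) monoid_scheme \<Rightarrow> bool" where
  "flexibly_weakly_stable \<nu> G \<longleftrightarrow>
     (\<forall>n f. asymptotic_hom G n f \<and>
        (\<forall>\<gamma> \<in> carrier G - {\<one>\<^bsub>G\<^esub>}.
           (\<lambda>l. perm_dist (n l) (n l) (f l \<gamma>) \<one>\<^bsub>sym_group (n l)\<^esub>) \<longlonglongrightarrow> 1)
        \<longrightarrow> correctable \<nu> G n f)"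

definition BS_rigid :: "('a, 'b) monoid_scheme \<Rightarrow> bool" where
  "BS_rigid G \<longleftrightarrow> flexibly_BS_rigid (\<lambda>_ _. 0) G"

definition weakly_stable :: "('a, 'b) monoid_scheme \<Rightarrow> bool" where
  "weakly_stable G \<longleftrightarrow> flexibly_weakly_stable (\<lambda>_ _. 0) G"

end

theory Submission
  imports Defs
begin

text \<open>
  A residually finite group has, for every finite set \<open>F\<close> of its elements, a finite quotient
  in which no nontrivial element of \<open>F\<close> dies. Letting this quotient act on as many disjoint copies
  of itself as fit into \<open>{1..n}\<close>, and fixing the remaining points, gives a homomorphism to
  \<open>Sym(n)\<close> for which every nontrivial element of \<open>F\<close> has a bounded number of fixed points.
  A diagonal argument over an exhaustion by finite sets \<open>F\<close> yields genuine homomorphisms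
  \<open>g\<^sub>l\<close> whose fixed-point statistics \<open>N\<^sub>g\<^sub>,\<^sub>Q\<close> tend to the point mass at \<open>Q \<inter> {1}\<close>. The assumption of
  weak stability says that those of \<open>f\<^sub>l\<close> have the same limit, so rigidity applies.
\<close>

section \<open>Almost free actions from finite quotients\<close>

text \<open>Disjoint copies of the map \<open>p\<close> of \<open>{..<m}\<close>, laid out as
  consecutive blocks. The shifts by 1 translate between \<open>{1..n}\<close>, on which
  \<open>sym_group n\<close> acts, and quotients and remainders counted from 0. For
  \<open>m = 0\<close> this is the identity.\<close>

definition block_action :: "nat \<Rightarrow> nat \<Rightarrow> (nat \<Rightarrow> nat) \<Rightarrow> nat \<Rightarrow> nat" where
  "block_action m n p x =
     (if 1 \<le> x \<and> x \<le> n div m * m then 1 + ((x - 1) div m * m + p ((x - 1) mod m)) else x)"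

lemma block_bound:
  fixes d r m k :: nat
  assumes "d < k" "r < m"
  shows "d * m + r < k * m"
proof -
  have "d * m + r < Suc d * m" using assms(2) by simp
  also have "\<dots> \<le> k * m" using assms(1) by (intro mult_right_mono) auto
  finally show ?thesis .
qed

lemma block_action_in_range:
  assumes "p \<in> {..<m} \<rightarrow> {..<m}" "1 \<le> x" "x \<le> n div m * m"
  shows "block_action m n p x \<in> {1..n div m * m}"
    and "(block_action m n p x - 1) div m = (x - 1) div m"
    and "(block_action m n p x - 1) mod m = p ((x - 1) mod m)"
proof -
  have m: "m > 0" using assms(2,3) by (cases m) auto
  then have r: "p ((x - 1) mod m) < m" using assms(1) by (auto simp: Pi_iff)
  have "x - 1 < n div m * m" using assms(2,3) by linarith
  then have "(x - 1) div m < n div m" by (simp add: less_mult_imp_div_less)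
  from block_bound[OF this r]
  show "block_action m n p x \<in> {1..n div m * m}"
    using assms by (simp add: block_action_def)
  show "(block_action m n p x - 1) div m = (x - 1) div m"
    using assms r m by (simp add: block_action_def)
  show "(block_action m n p x - 1) mod m = p ((x - 1) mod m)"
    using assms r m by (simp add: block_action_def)
qed

text \<open>Since \<open>p\<close> stays in \<open>{..<m}\<close>, it keeps each point in its block
  and acts on the offset alone, which is where \<open>q\<close> is evaluated next.\<close>

lemma block_action_comp:
  assumes "p \<in> {..<m} \<rightarrow> {..<m}"
  shows "block_action m n (q \<circ> p) = block_action m n q \<circ> block_action m n p"
proof
  fix x
  show "block_action m n (q \<circ> p) x = (block_action m n q \<circ> block_action m n p) x"
  proof (cases "1 \<le> x \<and> x \<le> n div m * m")
    case True
    then show ?thesis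
      using block_action_in_range[OF assms, of x n]
      by (simp add: block_action_def[of m n q] block_action_def[of m n "q \<circ> p"])
  next
    case False
    then show ?thesis by (auto simp: block_action_def)
  qed
qed

lemma block_action_ident:
  assumes "\<And>r. r < m \<Longrightarrow> p r = r"
  shows "block_action m n p = id"
proof
  fix x show "block_action m n p x = id x"
  proof (cases "m = 0")
    case False
    then show ?thesis using assms[of "(x - 1) mod m"] by (auto simp: block_action_def)
  qed (auto simp: block_action_def)
qed

text \<open>By compatibility with composition, maps inverse to each other on \<open>{..<m}\<close>
  become inverse bijections of all of \<open>nat\<close>.\<close>

lemma block_action_permutes:
  assumes "p \<in> {..<m} \<rightarrow> {..<m}" "q \<in> {..<m} \<rightarrow> {..<m}"
    and "\<And>r. r < m \<Longrightarrow> p (q r) = r" "\<And>r. r < m \<Longrightarrow> q (p r) = r"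
  shows "block_action m n p permutes {1..n}"
proof -
  have "block_action m n p \<circ> block_action m n q = id" "block_action m n q \<circ> block_action m n p = id"
    using assms by (auto simp flip: block_action_comp intro!: block_action_ident)
  then have "bij (block_action m n p)" using o_bij by blast
  moreover have "block_action m n p x = x" if "x \<notin> {1..n}" for x
  proof -
    have "\<not> (1 \<le> x \<and> x \<le> n div m * m)"
      using that le_trans[OF _ div_times_less_eq_dividend[of n m]] by auto
    then show ?thesis by (auto simp: block_action_def)
  qed
  ultimately show ?thesis by (simp add: permutes_def bij_iff)
qed

text \<open>A fixed-point-free \<open>p\<close> moves every point of every block, so only the
  \<open>n mod m\<close> leftover points can be fixed. The bound does not grow with
  \<open>n\<close>.\<close>

lemma card_fixed_block_action:
  assumes "m > 0" "\<And>r. r < m \<Longrightarrow> p r \<noteq> r"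
  shows "card {x \<in> {1..n}. block_action m n p x = x} < m"
proof -
  have "block_action m n p x \<noteq> x" if "1 \<le> x" "x \<le> n div m * m" for x
  proof
    assume "block_action m n p x = x"
    then have "(x - 1) div m * m + p ((x - 1) mod m) = x - 1"
      using that by (simp add: block_action_def)
    then have "p ((x - 1) mod m) = (x - 1) mod m"
      by (metis add_left_cancel div_mult_mod_eq)
    then show False using assms by simp
  qed
  then have "{x \<in> {1..n}. block_action m n p x = x} \<subseteq> {n div m * m<..n}"
    by (force simp: not_le)
  from card_mono[OF _ this]
  have "card {x \<in> {1..n}. block_action m n p x = x} \<le> n - n div m * m" by simp
  also have "\<dots> = n mod m" by (simp add: minus_div_mult_eq_mod)
  finally show ?thesis using assms(1) by (meson le_less_trans mod_less_divisor)
qed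

text \<open>The left regular representation, transported to \<open>{..<m}\<close> by an enumeration
  \<open>e\<close> and repeated in blocks. Left translation by a nontrivial element has no fixed
  point.\<close>

lemma (in group) almost_free_action:
  assumes fin: "finite (carrier G)"
  obtains \<phi> where "\<phi> \<in> hom G (sym_group n)"
    "\<And>q. q \<in> carrier G \<Longrightarrow> q \<noteq> \<one> \<Longrightarrow> card {x \<in> {1..n}. \<phi> q x = x} < card (carrier G)"
proof -
  define m where "m = card (carrier G)"
  obtain e where e: "bij_betw e {..<m} (carrier G)"
    using ex_bij_betw_nat_finite[OF fin] by (auto simp: m_def atLeast0LessThan)
  define e' where "e' = the_inv_into {..<m} e"
  have e'e: "e' (e r) = r" if "r < m" for r
    using that e by (simp add: e'_def bij_betw_def the_inv_into_f_f)
  have ee': "e (e' q) = q" if "q \<in> carrier G" for q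
    using that e by (simp add: e'_def bij_betw_def f_the_inv_into_f)
  have e'm: "e' q < m" if "q \<in> carrier G" for q
    using that e bij_betw_the_inv_into[OF e] by (auto simp: e'_def bij_betw_def)
  have eG: "e r \<in> carrier G" if "r < m" for r
    using that e by (auto simp: bij_betw_def)
  define p where "p q r = e' (q \<otimes> e r)" for q r
  have pm: "p q \<in> {..<m} \<rightarrow> {..<m}" if "q \<in> carrier G" for q
    using that by (auto simp: p_def e'm eG)
  have p_mult: "p (q \<otimes> q') r = p q (p q' r)" if "q \<in> carrier G" "q' \<in> carrier G" "r < m" for q q' r
    using that by (simp add: p_def ee' eG m_assoc)
  have p_one: "p \<one> r = r" if "r < m" for r
    using that by (simp add: p_def e'e eG)
  have "block_action m n (p q) permutes {1..n}" if "q \<in> carrier G" for q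
    using that by (intro block_action_permutes[of _ _ "p (inv q)"])
      (auto simp: pm p_one simp flip: p_mult)
  moreover have "block_action m n (p (q \<otimes> q')) = block_action m n (p q) \<circ> block_action m n (p q')"
    if "q \<in> carrier G" "q' \<in> carrier G" for q q'
  proof -
    \<comment> \<open>The two inner maps are known to agree only below \<open>m\<close>, but for
      \<open>m > 0\<close> only remainders modulo \<open>m\<close> are ever inserted.\<close>
    have "block_action m n (p (q \<otimes> q')) = block_action m n (p q \<circ> p q')"
    proof
      fix x show "block_action m n (p (q \<otimes> q')) x = block_action m n (p q \<circ> p q') x"
      proof (cases "m = 0")
        case False
        then show ?thesis using that by (simp add: block_action_def p_mult)
      qed (simp add: block_action_def)
    qed
    then show ?thesis using that by (simp add: block_action_comp pm)
  qed
  ultimately have "(\<lambda>q. block_action m n (p q)) \<in> hom G (sym_group n)"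
    by (simp add: hom_def sym_group_carrier sym_group_mult)
  moreover have "card {x \<in> {1..n}. block_action m n (p q) x = x} < card (carrier G)"
    if "q \<in> carrier G" "q \<noteq> \<one>" for q
    unfolding m_def[symmetric]
  proof (rule card_fixed_block_action)
    show "m > 0" using fin by (auto simp: m_def card_gt_0_iff)
    show "p q r \<noteq> r" if "r < m" for r
    proof
      assume "p q r = r"
      then have "q \<otimes> e r = e r"
        using ee'[of "q \<otimes> e r"] \<open>q \<in> carrier G\<close> eG[OF that] by (simp add: p_def)
      then show False using \<open>q \<in> carrier G\<close> \<open>q \<noteq> \<one>\<close> eG[OF that] r_cancel_one by blast
    qed
  qed
  ultimately show thesis using that by blast
qed

section \<open>Separating finite sets by finite quotients\<close>

lemma (in group) normal_Int:
  assumes "H \<lhd> G" "K \<lhd> G"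
  shows "H \<inter> K \<lhd> G"
  using assms unfolding normal_inv_iff by (auto intro: subgroups_Inter_pair)

text \<open>Right translation is injective, so a coset of \<open>H \<inter> K\<close> is the
  intersection of a coset of \<open>H\<close> with one of \<open>K\<close>; finitely many such pairs
  exist.\<close>

lemma (in group) finite_FactGroup_Int:
  assumes "subgroup H G" "subgroup K G"
    and "finite (carrier (G Mod H))" "finite (carrier (G Mod K))"
  shows "finite (carrier (G Mod (H \<inter> K)))"
proof -
  have "(H \<inter> K) #> a = (H #> a) \<inter> (K #> a)" if "a \<in> carrier G" for a
  proof -
    have "inj_on (\<lambda>h. h \<otimes> a) (carrier G)" using that by (simp add: inj_on_def)
    from inj_on_image_Int[OF this subgroup.subset[OF assms(1)] subgroup.subset[OF assms(2)]]
    show ?thesis by (simp add: r_coset_def UNION_singleton_eq_range)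
  qed
  then have "rcosets (H \<inter> K) \<subseteq> (\<lambda>(A, B). A \<inter> B) ` ((rcosets H) \<times> (rcosets K))"
    by (force simp: RCOSETS_def)
  then show ?thesis using assms(3,4) by (auto simp: FactGroup_def intro: finite_subset)
qed

text \<open>Induction on \<open>F\<close>: the whole group serves the empty set, and a new
  nontrivial element is handled by intersecting with a normal subgroup that avoids it.\<close>

lemma (in group) residually_finite_separates_finite:
  assumes "residually_finite_group G" "finite F" "F \<subseteq> carrier G"
  shows "\<exists>K. K \<lhd> G \<and> finite (carrier (G Mod K)) \<and> F \<inter> K \<subseteq> {\<one>}"
  using assms(2,3)
proof (induction F rule: finite_induct)
  case empty
  have "finite (rcosets (carrier G))"
    by (rule finite_subset[of _ "{carrier G}"])
      (auto simp: RCOSETS_def coset_join2 subgroup_self)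
  moreover have "carrier G \<lhd> G" by (simp add: normal_inv_iff subgroup_self)
  ultimately show ?case by (auto simp: FactGroup_def)
next
  case (insert g F)
  obtain K where K: "K \<lhd> G" "finite (carrier (G Mod K))" "F \<inter> K \<subseteq> {\<one>}"
    using insert by auto
  show ?case
  proof (cases "g = \<one>")
    case True
    then show ?thesis using K by blast
  next
    case False
    then obtain H where H: "H \<lhd> G" "finite (carrier (G Mod H))" "g \<notin> H"
      using assms(1) insert.prems by (auto simp: residually_finite_group_def)
    have "K \<inter> H \<lhd> G" "finite (carrier (G Mod (K \<inter> H)))"
      using H K by (auto intro: normal_Int finite_FactGroup_Int normal_imp_subgroup)
    then show ?thesis using H K by blast
  qed
qed

text \<open>Here \<open>m\<close> is the order of one quotient separating \<open>F\<close>. It is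
  chosen before the degree \<open>n\<close>, so the proportion of fixed points vanishes as
  \<open>n\<close> grows.\<close>

lemma (in group) residually_finite_almost_free:
  assumes "residually_finite_group G" "finite F" "F \<subseteq> carrier G"
  obtains m where "\<And>n. \<exists>\<phi> \<in> hom G (sym_group n).
    \<forall>\<gamma> \<in> F - {\<one>}. card {x \<in> {1..n}. \<phi> \<gamma> x = x} < m"
proof -
  obtain K where K: "K \<lhd> G" "finite (carrier (G Mod K))" "F \<inter> K \<subseteq> {\<one>}"
    using residually_finite_separates_finite[OF assms] by blast
  interpret K: normal K G by fact
  interpret Q: group "G Mod K" by (rule K.factorgroup_is_group)
  have "\<exists>\<phi> \<in> hom G (sym_group n).
      \<forall>\<gamma> \<in> F - {\<one>}. card {x \<in> {1..n}. \<phi> \<gamma> x = x} < card (carrier (G Mod K))" for n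
  proof -
    obtain \<phi> where \<phi>: "\<phi> \<in> hom (G Mod K) (sym_group n)"
      "\<And>q. q \<in> carrier (G Mod K) \<Longrightarrow> q \<noteq> \<one>\<^bsub>G Mod K\<^esub> \<Longrightarrow>
        card {x \<in> {1..n}. \<phi> q x = x} < card (carrier (G Mod K))"
      using Q.almost_free_action[OF K(2)] by blast
    have "\<phi> \<circ> (\<lambda>a. K #> a) \<in> hom G (sym_group n)"
      using K.r_coset_hom_Mod \<phi>(1) by (rule Group.hom_compose)
    moreover have "card {x \<in> {1..n}. (\<phi> \<circ> (\<lambda>a. K #> a)) \<gamma> x = x} < card (carrier (G Mod K))"
      if "\<gamma> \<in> F - {\<one>}" for \<gamma>
    proof -
      have \<gamma>: "\<gamma> \<in> carrier G" "\<gamma> \<notin> K" using that K(3) assms(3) by auto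
      then have "K #> \<gamma> \<noteq> K" using coset_join1 K.subgroup_axioms by blast
      then show ?thesis
        using \<phi>(2)[of "K #> \<gamma>"] \<gamma> by (simp add: FactGroup_def rcosetsI K.subset)
    qed
    ultimately show ?thesis by blast
  qed
  then show thesis using that by blast
qed

section \<open>Asymptotically free sequences of homomorphisms\<close>

text \<open>The stages \<open>B k\<close> start from the unit, the generators and their inverses,
  and each adds all products of two earlier elements. They increase, so two factors always meet in a
  common stage.\<close>

lemma countable_generate:
  assumes "countable S"
  shows "countable (generate G S)"
proof -
  define T where "T = insert \<one>\<^bsub>G\<^esub> (S \<union> (\<lambda>s. inv\<^bsub>G\<^esub> s) ` S)"
  define B where "B = rec_nat T (\<lambda>_ A. A \<union> (\<lambda>(a, b). a \<otimes>\<^bsub>G\<^esub> b) ` (A \<times> A))"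
  have B_Suc: "B (Suc k) = B k \<union> (\<lambda>(a, b). a \<otimes>\<^bsub>G\<^esub> b) ` (B k \<times> B k)" and B_0: "B 0 = T" for k
    by (simp_all add: B_def)
  have "countable (B k)" for k
    by (induction k) (use assms in \<open>auto simp: B_0 B_Suc T_def\<close>)
  moreover have mono: "mono B" by (auto simp: mono_iff_le_Suc B_Suc)
  have "x \<in> (\<Union>k. B k)" if "x \<in> generate G S" for x
    using that
  proof induction
    case (eng a b)
    then obtain i j where "a \<in> B i" "b \<in> B j" by blast
    then have "a \<in> B (max i j)" "b \<in> B (max i j)"
      using monoD[OF mono, of _ "max i j"] by (meson max.cobounded1 max.cobounded2 subsetD)+
    then have "a \<otimes>\<^bsub>G\<^esub> b \<in> B (Suc (max i j))" by (force simp: B_Suc)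
    then show ?case by blast
  qed (use B_0 in \<open>auto simp: T_def intro!: exI[of _ 0]\<close>)
  ultimately show ?thesis
    by (meson countable_UN countable_subset countableI_type subsetI)
qed

text \<open>Take the largest admissible level at each \<open>l\<close>: the cap
  \<open>k \<le> l\<close> makes the maximum exist, level 0 makes the set nonempty, and every fixed
  level is eventually admissible.\<close>

lemma diagonal_eventually:
  fixes P :: "nat \<Rightarrow> nat \<Rightarrow> bool"
  assumes "\<And>l. P 0 l" "\<And>k. eventually (P k) sequentially"
  obtains \<kappa> where "filterlim \<kappa> at_top sequentially" "\<And>l. P (\<kappa> l) l"
proof
  define \<kappa> where "\<kappa> l = Max {k. k \<le> l \<and> P k l}" for l
  have fin: "finite {k. k \<le> l \<and> P k l}" for l by simp
  have "\<kappa> l \<in> {k. k \<le> l \<and> P k l}" for l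
    unfolding \<kappa>_def using assms(1) by (intro Max_in fin) auto
  then show "P (\<kappa> l) l" for l by blast
  show "filterlim \<kappa> at_top sequentially"
    unfolding filterlim_at_top
  proof
    fix k
    show "\<forall>\<^sub>F l in sequentially. k \<le> \<kappa> l"
      using assms(2)[of k] eventually_ge_at_top[of k]
      by eventually_elim (simp add: \<kappa>_def fin)
  qed
qed

text \<open>Level \<open>k\<close> controls the first \<open>k\<close> elements of an enumeration up
  to a proportion \<open>1/k\<close> of fixed points. It is attainable once \<open>n l\<close> is
  large, and the diagonal lemma lets the level tend to infinity.\<close>

lemma (in group) asymptotically_free_homs:
  assumes rf: "residually_finite_group G" and count: "countable (carrier G)"
    and n: "filterlim n at_top sequentially"
  obtains g where "\<And>l. g l \<in> hom G (sym_group (n l))"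
    "\<And>\<gamma>. \<gamma> \<in> carrier G \<Longrightarrow> \<gamma> \<noteq> \<one> \<Longrightarrow>
       (\<lambda>l. real (card {x \<in> {1..n l}. g l \<gamma> x = x}) / real (n l)) \<longlonglongrightarrow> 0"
proof -
  define F where "F k = from_nat_into (carrier G) ` {..<k}" for k :: nat
  have F: "finite (F k)" "F k \<subseteq> carrier G" for k
    by (auto simp: F_def intro!: from_nat_into)
  \<comment> \<open>The proportion bound is written without division, so it also makes sense for
    \<open>k = 0\<close> or \<open>n l = 0\<close>.\<close>
  define good where "good k l \<phi> \<longleftrightarrow> \<phi> \<in> hom G (sym_group (n l)) \<and>
    (\<forall>\<gamma> \<in> F k - {\<one>}. k * card {x \<in> {1..n l}. \<phi> \<gamma> x = x} \<le> n l)" for k l \<phi>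
  have "\<exists>\<phi>. good 0 l \<phi>" for l
    using trivial_hom[OF sym_group_is_group] by (auto simp: good_def)
  moreover have "\<forall>\<^sub>F l in sequentially. \<exists>\<phi>. good k l \<phi>" for k
  proof -
    obtain m where m: "\<And>n. \<exists>\<phi> \<in> hom G (sym_group n).
        \<forall>\<gamma> \<in> F k - {\<one>}. card {x \<in> {1..n}. \<phi> \<gamma> x = x} < m"
      using residually_finite_almost_free[OF rf F] by blast
    have "\<forall>\<^sub>F l in sequentially. k * m \<le> n l"
      using n by (simp add: filterlim_at_top)
    then show ?thesis
    proof eventually_elim
      case (elim l)
      obtain \<phi> where \<phi>: "\<phi> \<in> hom G (sym_group (n l))"
        "\<forall>\<gamma> \<in> F k - {\<one>}. card {x \<in> {1..n l}. \<phi> \<gamma> x = x} < m"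
        using m by blast
      then have "k * card {x \<in> {1..n l}. \<phi> \<gamma> x = x} \<le> n l" if "\<gamma> \<in> F k - {\<one>}" for \<gamma>
        using that elim by (meson le_trans less_imp_le mult_le_mono2)
      then show ?case using \<phi>(1) by (auto simp: good_def)
    qed
  qed
  ultimately obtain \<kappa> where \<kappa>: "filterlim \<kappa> at_top sequentially" "\<And>l. \<exists>\<phi>. good (\<kappa> l) l \<phi>"
    using diagonal_eventually[of "\<lambda>k l. \<exists>\<phi>. good k l \<phi>"] by blast
  obtain g where g: "\<And>l. good (\<kappa> l) l (g l)" using \<kappa>(2) by metis
  show thesis
  proof
    show "g l \<in> hom G (sym_group (n l))" for l using g by (simp add: good_def)
    fix \<gamma> assume \<gamma>: "\<gamma> \<in> carrier G" "\<gamma> \<noteq> \<one>"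
    obtain i where i: "\<gamma> = from_nat_into (carrier G) i"
      using \<gamma>(1) count from_nat_into_surj by metis
    \<comment> \<open>This puts \<gamma> among the controlled elements and also makes
      \<open>\<kappa> l\<close> positive, so that it can be divided by.\<close>
    have "\<forall>\<^sub>F l in sequentially. Suc i \<le> \<kappa> l" using \<kappa>(1) by (simp add: filterlim_at_top)
    moreover have "\<forall>\<^sub>F l in sequentially. 1 \<le> n l" using n by (simp add: filterlim_at_top)
    ultimately have "\<forall>\<^sub>F l in sequentially.
        real (card {x \<in> {1..n l}. g l \<gamma> x = x}) / real (n l) \<le> inverse (real (\<kappa> l))"
    proof eventually_elim
      case (elim l)
      have "\<gamma> \<in> F (\<kappa> l)" using elim i by (auto simp: F_def)
      then have "\<kappa> l * card {x \<in> {1..n l}. g l \<gamma> x = x} \<le> n l"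
        using g[of l] \<gamma>(2) by (simp add: good_def)
      then have "real (\<kappa> l) * real (card {x \<in> {1..n l}. g l \<gamma> x = x}) \<le> real (n l)"
        by (metis of_nat_le_iff of_nat_mult)
      then show ?case using elim by (simp add: field_simps)
    qed
    moreover have "(\<lambda>l. inverse (real (\<kappa> l))) \<longlonglongrightarrow> 0"
      using filterlim_compose[OF filterlim_real_sequentially \<kappa>(1)]
      by (rule tendsto_inverse_0_at_top)
    ultimately show "(\<lambda>l. real (card {x \<in> {1..n l}. g l \<gamma> x = x}) / real (n l)) \<longlonglongrightarrow> 0"
      by (rule tendsto_sandwich[OF always_eventually _ tendsto_const, rotated]) simp
  qed
qed

section \<open>Convergence of the fixed-point statistics\<close>

text \<open>Compares two distributions through the point mass at \<open>a\<close>. Off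
  \<open>a\<close>, the difference is at most the sum of the masses, and the factor 1/2 absorbs the
  doubling.\<close>

lemma tv_dist_le:
  assumes "finite X" "a \<in> X"
  shows "tv_dist X p q \<le> (1 - pmf p a) + (1 - pmf q a)"
proof -
  have rest: "(\<Sum>x\<in>X - {a}. pmf r x) \<le> 1 - pmf r a" for r
  proof -
    have "(\<Sum>x\<in>X. pmf r x) \<le> 1"
      using assms(1) measure_pmf.prob_le_1[of r X] by (simp add: measure_measure_pmf_finite)
    then show ?thesis using assms by (simp add: sum.remove[of X a])
  qed
  have "(\<Sum>x\<in>X. \<bar>pmf p x - pmf q x\<bar>)
      = \<bar>pmf p a - pmf q a\<bar> + (\<Sum>x\<in>X - {a}. \<bar>pmf p x - pmf q x\<bar>)"
    using assms by (simp add: sum.remove)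
  also have "\<dots> \<le> ((1 - pmf p a) + (1 - pmf q a)) + (\<Sum>x\<in>X - {a}. pmf p x + pmf q x)"
    using pmf_le_1[of p a] pmf_le_1[of q a] pmf_nonneg[of p] pmf_nonneg[of q]
    by (intro add_mono sum_mono) (auto simp: abs_le_iff add_increasing add_increasing2)
  also have "\<dots> \<le> 2 * ((1 - pmf p a) + (1 - pmf q a))"
    using rest[of p] rest[of q] by (simp add: sum.distrib)
  finally show ?thesis by (simp add: tv_dist_def)
qed

text \<open>A union bound: the random set differs from \<open>Q \<inter> A\<close> only if some
  single element of \<open>Q\<close> is misplaced.\<close>

lemma one_minus_pmf_fix_distr_le:
  assumes "finite Q" "1 \<le> n"
  shows "1 - pmf (fix_distr n f Q) (Q \<inter> A)
    \<le> (\<Sum>\<gamma>\<in>Q. real (card {x \<in> {1..n}. (f \<gamma> x = x) \<noteq> (\<gamma> \<in> A)}) / real n)"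
proof -
  define E where "E = (\<lambda>x. {\<gamma> \<in> Q. f \<gamma> x = x}) -` {Q \<inter> A}"
  have "1 - pmf (fix_distr n f Q) (Q \<inter> A) = measure (measure_pmf (pmf_of_set {1..n})) (- E)"
    using measure_pmf.prob_compl[of E "pmf_of_set {1..n}"]
    by (simp add: fix_distr_def pmf_map E_def Compl_eq_Diff_UNIV)
  also have "\<dots> = real (card ({1..n} \<inter> - E)) / real n"
    using assms(2) by (subst measure_pmf_of_set) auto
  also have "card ({1..n} \<inter> - E) \<le> card (\<Union>\<gamma>\<in>Q. {x \<in> {1..n}. (f \<gamma> x = x) \<noteq> (\<gamma> \<in> A)})"
    using assms(1) by (intro card_mono) (auto simp: E_def)
  also have "\<dots> \<le> (\<Sum>\<gamma>\<in>Q. card {x \<in> {1..n}. (f \<gamma> x = x) \<noteq> (\<gamma> \<in> A)})"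
    using assms(1) by (rule card_UN_le)
  finally show ?thesis
    by (simp add: divide_right_mono flip: sum_divide_distrib of_nat_sum)
qed

text \<open>Both statistics approach the point mass at \<open>Q \<inter> A\<close>, hence each
  other.\<close>

lemma tv_dist_fix_distr_tendsto_0:
  assumes "finite Q" "\<And>l. 1 \<le> n l"
    and f: "\<And>\<gamma>. \<gamma> \<in> Q \<Longrightarrow>
      (\<lambda>l. real (card {x \<in> {1..n l}. (f l \<gamma> x = x) \<noteq> (\<gamma> \<in> A)}) / real (n l)) \<longlonglongrightarrow> 0"
    and g: "\<And>\<gamma>. \<gamma> \<in> Q \<Longrightarrow>
      (\<lambda>l. real (card {x \<in> {1..n l}. (g l \<gamma> x = x) \<noteq> (\<gamma> \<in> A)}) / real (n l)) \<longlonglongrightarrow> 0"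
  shows "(\<lambda>l. tv_dist (Pow Q) (fix_distr (n l) (f l) Q) (fix_distr (n l) (g l) Q)) \<longlonglongrightarrow> 0"
proof (rule tendsto_sandwich[OF _ _ tendsto_const])
  show "\<forall>\<^sub>F l in sequentially.
      0 \<le> tv_dist (Pow Q) (fix_distr (n l) (f l) Q) (fix_distr (n l) (g l) Q)"
    by (simp add: tv_dist_def sum_nonneg)
  show "\<forall>\<^sub>F l in sequentially.
      tv_dist (Pow Q) (fix_distr (n l) (f l) Q) (fix_distr (n l) (g l) Q)
      \<le> (\<Sum>\<gamma>\<in>Q. real (card {x \<in> {1..n l}. (f l \<gamma> x = x) \<noteq> (\<gamma> \<in> A)}) / real (n l))
        + (\<Sum>\<gamma>\<in>Q. real (card {x \<in> {1..n l}. (g l \<gamma> x = x) \<noteq> (\<gamma> \<in> A)}) / real (n l))"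
    using assms(1,2)
    by (intro always_eventually allI
        order_trans[OF tv_dist_le[of "Pow Q" "Q \<inter> A"]] add_mono one_minus_pmf_fix_distr_le) auto
  show "(\<lambda>l. (\<Sum>\<gamma>\<in>Q. real (card {x \<in> {1..n l}. (f l \<gamma> x = x) \<noteq> (\<gamma> \<in> A)}) / real (n l))
        + (\<Sum>\<gamma>\<in>Q. real (card {x \<in> {1..n l}. (g l \<gamma> x = x) \<noteq> (\<gamma> \<in> A)}) / real (n l)))
      \<longlonglongrightarrow> 0"
    using tendsto_add[OF tendsto_sum[of Q, OF f] tendsto_sum[of Q, OF g]] by simp
qed

text \<open>
  Since \<open>f\<^sub>l(1)\<close> is injective, \<open>f\<^sub>l(1)\<close> and \<open>f\<^sub>l(1)\<^sup>2\<close> differ exactly at the points moved by \<open>f\<^sub>l(1)\<close>.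
\<close>

lemma asymptotic_hom_one:
  assumes "group G" "asymptotic_hom G n f"
  shows "(\<lambda>l. real (card {x \<in> {1..n l}. f l \<one>\<^bsub>G\<^esub> x \<noteq> x}) / real (n l)) \<longlonglongrightarrow> 0"
proof -
  interpret group G by fact
  have "(\<lambda>l. perm_dist (n l) (n l) (f l (\<one>\<^bsub>G\<^esub> \<otimes>\<^bsub>G\<^esub> \<one>\<^bsub>G\<^esub>))
      (f l \<one>\<^bsub>G\<^esub> \<otimes>\<^bsub>sym_group (n l)\<^esub> f l \<one>\<^bsub>G\<^esub>)) \<longlonglongrightarrow> 0"
    using assms(2) one_closed unfolding asymptotic_hom_def by blast
  moreover have "(f l \<one>\<^bsub>G\<^esub> x \<noteq> f l \<one>\<^bsub>G\<^esub> (f l \<one>\<^bsub>G\<^esub> x)) \<longleftrightarrow> f l \<one>\<^bsub>G\<^esub> x \<noteq> x" for l x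
  proof -
    have "f l \<one>\<^bsub>G\<^esub> permutes {1..n l}"
      using assms(2) one_closed unfolding asymptotic_hom_def Pi_iff sym_group_carrier by blast
    then show ?thesis by (metis permutes_inj injD)
  qed
  ultimately show ?thesis by (simp add: perm_dist_def sym_group_mult)
qed

lemma perm_dist_one_tendsto_1:
  assumes "\<And>l. 1 \<le> n l"
    and "(\<lambda>l. perm_dist (n l) (n l) (p l) \<one>\<^bsub>sym_group (n l)\<^esub>) \<longlonglongrightarrow> 1"
  shows "(\<lambda>l. real (card {x \<in> {1..n l}. p l x = x}) / real (n l)) \<longlonglongrightarrow> 0"
proof -
  have "real (card {x \<in> {1..n l}. p l x = x}) / real (n l)
      = 1 - perm_dist (n l) (n l) (p l) \<one>\<^bsub>sym_group (n l)\<^esub>" for l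
  proof -
    have "card {x \<in> {1..n l}. p l x = x} + card {x \<in> {1..n l}. p l x \<noteq> x}
        = card ({x \<in> {1..n l}. p l x = x} \<union> {x \<in> {1..n l}. p l x \<noteq> x})"
      by (rule card_Un_disjoint[symmetric]) auto
    also have "{x \<in> {1..n l}. p l x = x} \<union> {x \<in> {1..n l}. p l x \<noteq> x} = {1..n l}" by auto
    finally have "real (card {x \<in> {1..n l}. p l x = x})
        = real (n l) - real (card {x \<in> {1..n l}. p l x \<noteq> x})" by simp
    then show ?thesis
      using assms(1)[of l] by (simp add: perm_dist_def sym_group_one diff_divide_distrib)
  qed
  then show ?thesis using tendsto_diff[OF tendsto_const[of 1] assms(2)] by simp
qed

section \<open>From rigidity to weak stability\<close>

lemma flexibly_BS_rigid_imp_flexibly_weakly_stable: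
  assumes fg: "finitely_generated_group G" and rf: "residually_finite_group G"
    and rigid: "flexibly_BS_rigid \<nu> G"
  shows "flexibly_weakly_stable \<nu> G"
  unfolding flexibly_weakly_stable_def
proof (intro allI impI, elim conjE)
  fix n f
  assume f: "asymptotic_hom G n f"
    and free: "\<forall>\<gamma> \<in> carrier G - {\<one>\<^bsub>G\<^esub>}.
      (\<lambda>l. perm_dist (n l) (n l) (f l \<gamma>) \<one>\<^bsub>sym_group (n l)\<^esub>) \<longlonglongrightarrow> 1"
  interpret group G using rf by (simp add: residually_finite_group_def)
  have n: "\<And>l. 1 \<le> n l" "filterlim n at_top sequentially"
    using f by (auto simp: asymptotic_hom_def)
  \<comment> \<open>Finite generation enters here: the diagonal argument enumerates the
    group.\<close>
  have "countable (carrier G)"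
    using fg countable_generate by (metis finitely_generated_group_def countable_finite)
  then obtain g where g: "\<And>l. g l \<in> hom G (sym_group (n l))"
    "\<And>\<gamma>. \<gamma> \<in> carrier G \<Longrightarrow> \<gamma> \<noteq> \<one>\<^bsub>G\<^esub> \<Longrightarrow>
       (\<lambda>l. real (card {x \<in> {1..n l}. g l \<gamma> x = x}) / real (n l)) \<longlonglongrightarrow> 0"
    using asymptotically_free_homs[OF rf _ n(2)] by blast
  have g1: "g l \<one>\<^bsub>G\<^esub> = id" for l
    using hom_one[OF g(1) is_group sym_group_is_group] by (simp add: sym_group_one)
  have "(\<lambda>l. tv_dist (Pow Q) (fix_distr (n l) (f l) Q) (fix_distr (n l) (g l) Q)) \<longlonglongrightarrow> 0"
    if "finite Q" "Q \<subseteq> carrier G" for Q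
  \<comment> \<open>With this \<open>A\<close>, the misplaced points are the moved ones for the unit
    and the fixed ones for every other element.\<close>
  proof (rule tv_dist_fix_distr_tendsto_0[OF that(1) n(1), where A = "{\<one>\<^bsub>G\<^esub>}"])
    fix \<gamma> assume "\<gamma> \<in> Q"
    then have \<gamma>: "\<gamma> \<in> carrier G" using that by blast
    show "(\<lambda>l. real (card {x \<in> {1..n l}. (f l \<gamma> x = x) \<noteq> (\<gamma> \<in> {\<one>\<^bsub>G\<^esub>})}) / real (n l)) \<longlonglongrightarrow> 0"
    proof (cases "\<gamma> = \<one>\<^bsub>G\<^esub>")
      case True
      \<comment> \<open>Unlike \<open>g l\<close>, the map \<open>f l\<close> need not send the unit
        to the identity; it does so only asymptotically.\<close>
      then show ?thesis using asymptotic_hom_one[OF is_group f] by simp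
    next
      case False
      then show ?thesis
        using perm_dist_one_tendsto_1[of n "\<lambda>l. f l \<gamma>", OF n(1)] free \<gamma> by simp
    qed
    show "(\<lambda>l. real (card {x \<in> {1..n l}. (g l \<gamma> x = x) \<noteq> (\<gamma> \<in> {\<one>\<^bsub>G\<^esub>})}) / real (n l)) \<longlonglongrightarrow> 0"
      using g(2) \<gamma> by (cases "\<gamma> = \<one>\<^bsub>G\<^esub>") (auto simp: g1)
  qed
  with g(1) have "\<exists>g. (\<forall>l. g l \<in> hom G (sym_group (n l))) \<and>
      (\<forall>Q. finite Q \<and> Q \<subseteq> carrier G \<longrightarrow>
        (\<lambda>l. tv_dist (Pow Q) (fix_distr (n l) (f l) Q) (fix_distr (n l) (g l) Q)) \<longlonglongrightarrow> 0)"
    by (intro exI[of _ g] conjI allI impI) simp_all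
  with f show "correctable \<nu> G n f"
    by (intro rigid[unfolded flexibly_BS_rigid_def, rule_format] conjI)
qed

theorem proposition1p27:
  fixes G :: "('a, 'b) monoid_scheme"
    and \<nu> :: "real \<Rightarrow> nat \<Rightarrow> enat"
  assumes "\<And>n. 1 \<le> n \<Longrightarrow> mono_on {0<..} (\<lambda>\<epsilon>. \<nu> \<epsilon> n)"
    and "group G"
    and "finitely_generated_group G"
    and "residually_finite_group G"
  shows "(BS_rigid G \<longrightarrow> weakly_stable G) \<and>
         (flexibly_BS_rigid \<nu> G \<longrightarrow> flexibly_weakly_stable \<nu> G)"
  \<comment> \<open>The lemma is used for two flexibility functions: the constant 0 and the given
    \<nu>.\<close>
  using flexibly_BS_rigid_imp_flexibly_weakly_stable[OF assms(3,4)]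
  by (simp add: BS_rigid_def weakly_stable_def)

end
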